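(* Let $\tilde{\pi}_0$ and $\tilde{\pi}_1$ be arbitrary (possibly unnormalized) density functions, let $\beta \in [0,1]$ be a mixing parameter, let $q$ be a real order parameter, and set $\alpha = 2q-1$. Define the $q$-path density $$\tilde{\pi}_{\beta,q}(z) = \Big[(1-\beta)\,\tilde{\pi}_0(z)^{1-q} + \beta\,\tilde{\pi}_1(z)^{1-q}\Big]^{\frac{1}{1-q}}$$ (understood for $q=1$ as its limit, the geometric mixture $\tilde{\pi}_0(z)^{1-\beta}\,\tilde{\pi}_1(z)^{\beta}$). Then $\tilde{\pi}_{\beta,q}$ minimizes the expected $\alpha$-divergence to the endpoints: $$\tilde{\pi}_{\beta,q} = \operatorname*{argmin}_{\tilde{r}} \; (1-\beta)\, D_{\alpha}[\tilde{\pi}_0 \,\|\, \tilde{r}] + \beta\, D_{\alpha}[\tilde{\pi}_1 \,\|\, \tilde{r}],$$ where the optimization is over arbitrary unnormalized measures (densities) $\tilde{r}(z)$, with no normalization or parametric constraint.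
   Context: Amari's $\alpha$-divergence over unnormalized measures with densities $\tilde{p}_1, \tilde{p}_2$ is $$D_{\alpha}[\tilde{p}_1 \,\|\, \tilde{p}_2] = \frac{4}{1-\alpha^2}\left( \frac{1-\alpha}{2}\int \tilde{p}_1(z)\,dz + \frac{1+\alpha}{2}\int \tilde{p}_2(z)\,dz - \int \tilde{p}_1(z)^{\frac{1-\alpha}{2}}\,\tilde{p}_2(z)^{\frac{1+\alpha}{2}}\,dz\right).$$ With $\alpha = 2q-1$ one has $\frac{1-\alpha}{2} = 1-q$, $\frac{1+\alpha}{2} = q$ and $\frac{4}{1-\alpha^2} = \frac{1}{q(1-q)}$. The cases $q = 1$ ($\alpha=1$) and $q=0$ ($\alpha=-1$) are understood as limits: with the Kullback–Leibler divergence extended to unnormalized measures, $D_{\mathrm{KL}}[\tilde{p}_1 \| \tilde{p}_2] = \int \tilde{p}_1(z)\log\frac{\tilde{p}_1(z)}{\tilde{p}_2(z)}\,dz - \int \tilde{p}_1(z)\,dz + \int \tilde{p}_2(z)\,dz$, the divergence $D_\alpha[\tilde{p}_1\|\tilde{p}_2]$ tends to $D_{\mathrm{KL}}[\tilde{p}_2\|\tilde{p}_1]$ (order of arguments reversed) as $q\to 1$ and to $D_{\mathrm{KL}}[\tilde{p}_1\|\tilde{p}_2]$ as $q \to 0$. *)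

theory Defs
  imports "HOL-Analysis.Analysis"
begin

text \<open>Densities are taken with respect to an arbitrary reference measure \<open>M\<close> (the \<open>dz\<close> of the
  integrals). They need not be normalized and may vanish, but have finite total mass, so that
  the sums and differences of integrals in the divergences below are meaningful.\<close>

definition unnormalized_density :: "'a measure \<Rightarrow> ('a \<Rightarrow> real) \<Rightarrow> bool" where
  "unnormalized_density M p \<longleftrightarrow> integrable M p \<and> (\<forall>z\<in>space M. 0 \<le> p z)"

text \<open>Real powers on \<open>[0, \<infinity>]\<close>, with \<open>x\<^sup>0 = 1\<close>, \<open>0\<^sup>a = \<infinity>\<close> and \<open>\<infinity>\<^sup>a = 0\<close> for \<open>a < 0\<close>. The
  library's \<^const>\<open>powr\<close> on the reals sets every power of \<open>0\<close> to \<open>0\<close>, which is wrong at zeros of a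
  density when the exponent is not positive.\<close>

definition epow :: "ennreal \<Rightarrow> real \<Rightarrow> ennreal" where
  "epow x a =
    (if a = 0 then 1
     else if x = 0 then (if 0 < a then 0 else \<infinity>)
     else if x = \<infinity> then (if 0 < a then \<infinity> else 0)
     else ennreal (enn2real x powr a))"

text \<open>For \<open>0 \<le> \<beta> \<le> 1\<close> and nonnegative \<open>p0\<close>, \<open>p1\<close> the extended value below is a (weighted) power mean
  of two finite numbers, hence finite, and \<^const>\<open>enn2real\<close> loses nothing. As usual in
  \<^typ>\<open>ennreal\<close>, \<open>0 * \<infinity> = 0\<close>: an endpoint of weight zero is ignored.\<close>

definition q_path :: "real \<Rightarrow> real \<Rightarrow> ('a \<Rightarrow> real) \<Rightarrow> ('a \<Rightarrow> real) \<Rightarrow> 'a \<Rightarrow> real" where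
  "q_path \<beta> q p0 p1 z = enn2real
    (if q = 1 then epow (ennreal (p0 z)) (1 - \<beta>) * epow (ennreal (p1 z)) \<beta>
     else epow (ennreal (1 - \<beta>) * epow (ennreal (p0 z)) (1 - q)
                + ennreal \<beta> * epow (ennreal (p1 z)) (1 - q)) (1 / (1 - q)))"

text \<open>Integral of an extended-real function as positive part minus negative part; meaningful
  when one of the two is finite.\<close>

definition ext_integral :: "'a measure \<Rightarrow> ('a \<Rightarrow> ereal) \<Rightarrow> ereal" where
  "ext_integral M f = enn2ereal (\<integral>\<^sup>+ z. e2ennreal (f z) \<partial>M) - enn2ereal (\<integral>\<^sup>+ z. e2ennreal (- f z) \<partial>M)"

text \<open>\<open>a log (a / b)\<close> with the usual conventions \<open>0 log (0 / b) = 0\<close> and \<open>a log (a / 0) = \<infinity>\<close>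
  for \<open>a > 0\<close>.\<close>

definition xlog_ratio :: "real \<Rightarrow> real \<Rightarrow> ereal" where
  "xlog_ratio a b = (if a = 0 then 0 else if b = 0 then \<infinity> else ereal (a * ln (a / b)))"

text \<open>The negative part of \<open>p1 log (p1 / p2)\<close> is at most \<open>p2\<close>, so for densities of finite mass the
  extended integral is well defined. The library's \<open>KL_divergence\<close> is real-valued and
  does not treat unnormalized measures.\<close>

definition KL_unnormalized :: "'a measure \<Rightarrow> ('a \<Rightarrow> real) \<Rightarrow> ('a \<Rightarrow> real) \<Rightarrow> ereal" where
  "KL_unnormalized M p1 p2 =
     ext_integral M (\<lambda>z. xlog_ratio (p1 z) (p2 z)) - ereal (\<integral> z. p1 z \<partial>M) + ereal (\<integral> z. p2 z \<partial>M)"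

text \<open>The values at \<open>\<alpha> = 1\<close> and \<open>\<alpha> = -1\<close> are the limits of the general formula; note the
  reversed order of the arguments at \<open>\<alpha> = 1\<close>. When the last integral is infinite, which for
  densities of finite mass can happen only if \<open>\<bar>\<alpha>\<bar> > 1\<close>, the leading factor is negative and the
  divergence is \<open>\<infinity>\<close>.\<close>

definition alpha_divergence :: "'a measure \<Rightarrow> real \<Rightarrow> ('a \<Rightarrow> real) \<Rightarrow> ('a \<Rightarrow> real) \<Rightarrow> ereal" where
  "alpha_divergence M \<alpha> p1 p2 =
    (if \<alpha> = 1 then KL_unnormalized M p2 p1
     else if \<alpha> = -1 then KL_unnormalized M p1 p2
     else ereal (4 / (1 - \<alpha>\<^sup>2)) *
       (ereal ((1 - \<alpha>) / 2 * (\<integral> z. p1 z \<partial>M)) + ereal ((1 + \<alpha>) / 2 * (\<integral> z. p2 z \<partial>M))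
        - enn2ereal (\<integral>\<^sup>+ z. epow (ennreal (p1 z)) ((1 - \<alpha>) / 2)
                              * epow (ennreal (p2 z)) ((1 + \<alpha>) / 2) \<partial>M)))"

definition expected_alpha_divergence ::
  "'a measure \<Rightarrow> real \<Rightarrow> real \<Rightarrow> ('a \<Rightarrow> real) \<Rightarrow> ('a \<Rightarrow> real) \<Rightarrow> ('a \<Rightarrow> real) \<Rightarrow> ereal" where
  "expected_alpha_divergence M \<alpha> \<beta> p0 p1 r =
     ereal (1 - \<beta>) * alpha_divergence M \<alpha> p0 r + ereal \<beta> * alpha_divergence M \<alpha> p1 r"

end

(* The divergence is the integral of a nonnegative density d(p, r) that vanishes only at p = r. With
   m the q-path, i.e. m^(1-q) the mixture of the endpoint powers, d satisfies pointwise the exact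
   compensation identity
     (1-b) d(p0, r) + b d(p1, r) = (1-b) d(p0, m) + b d(p1, m) + d(m, r),
   also where some terms are infinite. Integrating, the objective at r exceeds its value at m by
   D[m || r], which gives minimality. Uniqueness further needs the value at m to be finite; since it
   is minimal, a finite value anywhere suffices: take r = p0 + p1 for q < 1, r = min p0 p1 otherwise. *)

theory Submission
  imports Defs
begin

section \<open>Powers on the extended half-line\<close>

lemma epow_0 [simp]: "epow x 0 = 1"
  by (simp add: epow_def)

lemma epow_1 [simp]: "epow x 1 = x"
  by (auto simp: epow_def ennreal_enn2real_if)

lemma epow_ennreal: "0 < x \<Longrightarrow> epow (ennreal x) a = ennreal (x powr a)"
  by (auto simp: epow_def)

lemma epow_zero: "epow 0 a = (if a = 0 then 1 else if 0 < a then 0 else \<infinity>)"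
  by (simp add: epow_def)

lemma epow_top: "epow top a = (if a = 0 then 1 else if 0 < a then top else 0)"
  by (simp add: epow_def)

lemma ennreal_cases_zero_top:
  obtains "x = 0" | r where "0 < r" "x = ennreal r" | "x = \<infinity>"
proof (cases x)
  case (real r)
  then show ?thesis using that by (cases "r = 0") auto
next
  case top
  then show ?thesis using that by simp
qed

lemma epow_mono:
  assumes "x \<le> y" "0 \<le> a" shows "epow x a \<le> epow y a"
  using assms
  by (cases x rule: ennreal_cases_zero_top; cases y rule: ennreal_cases_zero_top)
     (auto simp: epow_zero epow_top epow_ennreal ennreal_le_iff powr_mono2 top_unique)

lemma epow_antimono:
  assumes "x \<le> y" "a \<le> 0" shows "epow y a \<le> epow x a"
  using assms
  by (cases x rule: ennreal_cases_zero_top; cases y rule: ennreal_cases_zero_top)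
     (auto simp: epow_zero epow_top epow_ennreal ennreal_le_iff powr_mono2' top_unique)

text \<open>A negative exponent swaps \<open>0\<close> and \<infinity>, so every nonzero exponent
  gives a bijection of [0, \<infinity>]. Hence powers can be undone even where a density
  vanishes.\<close>

lemma epow_epow_inverse:
  assumes "a \<noteq> 0" shows "epow (epow x a) (1 / a) = x"
  using assms
  by (cases x rule: ennreal_cases_zero_top)
     (auto simp: epow_zero epow_top epow_ennreal powr_powr)

lemma epow_inverse_epow:
  assumes "a \<noteq> 0" shows "epow (epow x (1 / a)) a = x"
  using epow_epow_inverse[of "1 / a" x] assms by simp

text \<open>At \<open>x = 0\<close> with \<open>q\<close> outside [0, 1] one factor is
  \<open>0\<close> and the other \<infinity>; the convention \<open>0 * \<infinity> = 0\<close> then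
  gives the right value.\<close>

lemma epow_mult_epow_complement:
  assumes "0 \<le> x" shows "epow (ennreal x) (1 - q) * epow (ennreal x) q = ennreal x"
  using assms by (cases "x = 0") (auto simp: epow_zero epow_ennreal simp flip: ennreal_mult powr_add)

lemma measurable_epow [measurable]: "(\<lambda>x. epow x a) \<in> borel_measurable borel"
  unfolding epow_def by measurable

lemma measurable_xlog_ratio [measurable (raw)]:
  assumes [measurable]: "f \<in> borel_measurable M" "g \<in> borel_measurable M"
  shows "(\<lambda>z. xlog_ratio (f z) (g z)) \<in> borel_measurable M"
  unfolding xlog_ratio_def by measurable

section \<open>Linearity of the extended integral\<close>

text \<open>The integrand has constant sign, so one of its two parts vanishes. Both signs of
  \<open>k\<close> occur, as the factor \<open>- 1 / (q * (1 - q))\<close> changes sign with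
  \<open>q\<close>.\<close>

lemma ext_integral_cmult_ennreal:
  assumes [measurable]: "f \<in> borel_measurable M"
  shows "ext_integral M (\<lambda>z. ereal k * enn2ereal (f z)) = ereal k * enn2ereal (\<integral>\<^sup>+ z. f z \<partial>M)"
proof -
  have pos: "e2ennreal (ereal c * enn2ereal x) = ennreal c * x" if "0 \<le> c" for c x
    using that by (metis e2ennreal_enn2ereal enn2ereal_ennreal times_ennreal.rep_eq)
  have neg: "e2ennreal (- (ereal c * enn2ereal x)) = 0" if "0 \<le> c" for c x
    using that by (intro e2ennreal_neg) (simp add: ereal_0_le_uminus_iff)
  show ?thesis
  proof (cases "0 \<le> k")
    case True
    then show ?thesis
      by (simp add: ext_integral_def pos neg nn_integral_cmult times_ennreal.rep_eq enn2ereal_ennreal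
          zero_ennreal.rep_eq)
  next
    case False
    then have k: "ereal k = - ereal (- k)" "0 \<le> - k" by auto
    show ?thesis
      unfolding k(1) ereal_mult_minus_left ereal_uminus_uminus
      using k(2) 
      by (simp only: ext_integral_def pos neg nn_integral_cmult times_ennreal.rep_eq enn2ereal_ennreal
          ereal_uminus_uminus assms)
         (simp add: zero_ennreal.rep_eq)
  qed
qed

text \<open>Nonnegativity of the sum bounds the negative part of \<open>g\<close> by the positive
  part of \<open>u\<close>, which has finite integral; so \<infinity> - \<infinity> cannot
  arise.\<close>

lemma ext_integral_add_real:
  assumes u: "integrable M u" and [measurable]: "g \<in> borel_measurable M"
    and nonneg: "\<And>z. z \<in> space M \<Longrightarrow> 0 \<le> ereal (u z) + g z"
  shows "ereal (\<integral>z. u z \<partial>M) + ext_integral M g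
         = enn2ereal (\<integral>\<^sup>+z. e2ennreal (ereal (u z) + g z) \<partial>M)"
proof -
  have [measurable]: "u \<in> borel_measurable M" using u by auto
  let ?A = "\<integral>\<^sup>+z. e2ennreal (ereal (u z) + g z) \<partial>M"
  let ?P = "\<integral>\<^sup>+z. ennreal (u z) \<partial>M" and ?N = "\<integral>\<^sup>+z. ennreal (- u z) \<partial>M"
  let ?GP = "\<integral>\<^sup>+z. e2ennreal (g z) \<partial>M" and ?GN = "\<integral>\<^sup>+z. e2ennreal (- g z) \<partial>M"
  have real_split: "ennreal (x + y) + ennreal (- x) + ennreal (- y) = ennreal x + ennreal y"
    if "0 \<le> x + y" for x y :: real
    using that
    by (cases "0 \<le> x"; cases "0 \<le> y") (auto simp: ennreal_neg simp flip: ennreal_plus)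
  \<comment> \<open>Negative parts are moved across so that only sums of nonnegative terms are
    integrated; subtraction returns once the parts are known to be finite.\<close>
  have pt: "e2ennreal (ereal (u z) + g z) + ennreal (- u z) + e2ennreal (- g z)
      = ennreal (u z) + e2ennreal (g z)" if "z \<in> space M" for z
    using nonneg[OF that] by (cases "g z") (simp_all add: real_split e2ennreal_neg)
  have ptN: "e2ennreal (- g z) \<le> ennreal (u z)" if "z \<in> space M" for z
    using nonneg[OF that] by (cases "g z") (simp_all add: ennreal_leI e2ennreal_neg)
  have "?A + ?N + ?GN = (\<integral>\<^sup>+z. e2ennreal (ereal (u z) + g z) + ennreal (- u z) + e2ennreal (- g z) \<partial>M)"
    by (simp add: nn_integral_add)
  also have "\<dots> = (\<integral>\<^sup>+z. ennreal (u z) + e2ennreal (g z) \<partial>M)"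
    by (intro nn_integral_cong pt)
  also have "\<dots> = ?P + ?GP" by (simp add: nn_integral_add)
  finally have sum: "?A + ?N + ?GN = ?P + ?GP" .
  have P: "?P < \<infinity>" and N: "?N < \<infinity>"
    using u by (auto simp: real_integrable_def less_top)
  have "?GN \<le> ?P" by (intro nn_integral_mono ptN)
  then have GN: "?GN < \<infinity>" using P by (rule le_less_trans)
  have int: "(\<integral>z. u z \<partial>M) = enn2real ?P - enn2real ?N"
    using u by (rule real_lebesgue_integral_def)
  show ?thesis
    unfolding ext_integral_def int
    using sum P N GN
    by (cases ?P; cases ?N; cases ?GN; cases ?GP; cases ?A)
       (auto simp: enn2ereal_ennreal top_ennreal.rep_eq simp flip: ennreal_plus)
qed


text \<open>The integrand of \<open>D\<^sub>\<alpha>\<close> for \<open>\<alpha> = 2 q - 1\<close>; collecting the linear terms inside the integral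
  makes it nonnegative.\<close>

definition div_density :: "real \<Rightarrow> real \<Rightarrow> real \<Rightarrow> ereal" where
  "div_density q a b =
    (if q = 1 then ereal (a - b) + xlog_ratio b a
     else if q = 0 then ereal (b - a) + xlog_ratio a b
     else ereal (a / q + b / (1 - q))
       + ereal (- 1 / (q * (1 - q))) * enn2ereal (epow (ennreal a) (1 - q) * epow (ennreal b) q))"

section \<open>Strict positivity of the divergence density off the diagonal\<close>

text \<open>After division by the weighted geometric mean \<open>u\<close> the weighted logarithms
  sum to zero, while \<open>ln t \<le> t - 1\<close> is strict for at least one of the points, since
  they cannot both equal \<open>u\<close>.\<close>

lemma weighted_AM_GM_strict:
  fixes x y s :: real
  assumes "0 < x" "0 < y" "0 < s" "s < 1" "x \<noteq> y"
  shows "x powr (1 - s) * y powr s < (1 - s) * x + s * y"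
proof -
  define u where "u = x powr (1 - s) * y powr s"
  have u: "0 < u" using assms by (simp add: u_def)
  have lnu: "ln u = (1 - s) * ln x + s * ln y"
    using assms by (simp add: u_def ln_mult ln_powr)
  have strict: "ln t < t - 1" if "0 < t" "t \<noteq> 1" for t :: real
    using ln_le_minus_one[OF that(1)] ln_eq_minus_one[OF that(1)] that(2) by fastforce
  have weak: "ln t \<le> t - 1" if "0 < t" for t :: real
    using ln_le_minus_one[OF that] .
  have "(1 - s) * ln (x / u) + s * ln (y / u) < (1 - s) * (x / u - 1) + s * (y / u - 1)"
  proof (cases "x = u")
    case True
    then have "y / u \<noteq> 1" using assms u by auto
    then have "s * ln (y / u) < s * (y / u - 1)" using strict assms u by simp
    then show ?thesis using True u by simp
  next
    case False
    then have "(1 - s) * ln (x / u) < (1 - s) * (x / u - 1)" using strict assms u by simp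
    moreover have "s * ln (y / u) \<le> s * (y / u - 1)" using weak assms u by simp
    ultimately show ?thesis by simp
  qed
  moreover have "(1 - s) * ln (x / u) + s * ln (y / u) = 0"
    using lnu u assms by (simp add: ln_div algebra_simps)
  moreover have "(1 - s) * (x / u - 1) + s * (y / u - 1) = ((1 - s) * x + s * y) / u - 1"
    using u by (simp add: field_simps)
  ultimately have "0 < ((1 - s) * x + s * y) / u - 1"
    by simp
  then show ?thesis using u by (simp add: u_def field_simps)
qed

text \<open>For \<open>q\<close> in (0, 1) this is weighted AM-GM. Outside, one of \<open>a\<close>,
  \<open>b\<close> is itself a weighted geometric mean of the other and the product, so the
  inequality reverses, as does the sign of \<open>q * (1 - q)\<close>.\<close>

lemma powr_tangent_gap:
  fixes a b q :: real
  assumes "0 < a" "0 < b" "a \<noteq> b" "q \<noteq> 0" "q \<noteq> 1"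
  shows "0 < ((1 - q) * a + q * b - a powr (1 - q) * b powr q) / (q * (1 - q))"
proof -
  let ?w = "a powr (1 - q) * b powr q"
  have w: "0 < ?w" using assms by simp
  \<comment> \<open>Outside (0, 1) the product takes the place of one argument of AM-GM, so
    strictness requires it to differ from the other.\<close>
  have neq: "?w \<noteq> c" if "c = a \<or> c = b" for c
  proof
    assume "?w = c"
    then have "ln ?w = ln c" by simp
    then have "(1 - q) * ln a + q * ln b = ln c" using assms by (simp add: ln_mult ln_powr)
    then have "q * (ln b - ln a) = 0 \<or> (1 - q) * (ln a - ln b) = 0"
      using that by (auto simp: algebra_simps)
    then show False using assms by auto
  qed
  consider "0 < q" "q < 1" | "1 < q" | "q < 0" using assms by linarith
  then show ?thesis
  proof cases
    case 1
    then show ?thesis using weighted_AM_GM_strict[of a b q] assms by simp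
  next
    case 2
    have "?w powr (1 / q) * a powr (1 - 1 / q) = b"
    proof -
      have "?w powr (1 / q) * a powr (1 - 1 / q) = a powr ((1 - q) / q + (1 - 1 / q)) * b"
        using 2 assms by (simp add: powr_mult powr_powr powr_add)
      also have "(1 - q) / q + (1 - 1 / q) = 0" using 2 by (simp add: field_simps)
      finally show ?thesis using assms by simp
    qed
    then have "b < (1 - 1 / q) * a + (1 / q) * ?w"
      using weighted_AM_GM_strict[of a ?w "1 / q"] 2 assms w neq[of a] by (simp add: mult.commute)
    then have "q * b < q * ((1 - 1 / q) * a + (1 / q) * ?w)" using 2 by simp
    also have "\<dots> = (q - 1) * a + ?w" using 2 by (simp add: field_simps)
    finally have "(1 - q) * a + q * b - ?w < 0" by (simp add: algebra_simps)
    moreover have "q * (1 - q) < 0" using 2 by (simp add: mult_pos_neg)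
    ultimately show ?thesis by (rule divide_neg_neg)
  next
    case 3
    \<comment> \<open>The weight of the product for which its factor \<open>a powr (1 - q)\<close>
      contributes \<open>a\<close> itself and the powers of \<open>b\<close> cancel.\<close>
    define t where "t = 1 / (1 - q)"
    have t: "0 < t" "t < 1" "t * (1 - q) = 1" using 3 by (auto simp: t_def)
    have "?w powr t * b powr (1 - t) = a"
    proof -
      have "?w powr t * b powr (1 - t) = a powr (t * (1 - q)) * b powr (q * t + (1 - t))"
        using assms by (simp add: powr_mult powr_powr powr_add mult.commute)
      also have "q * t + (1 - t) = 0" using t(3) by (simp add: algebra_simps)
      finally show ?thesis using assms t by simp
    qed
    then have "a < (1 - t) * b + t * ?w"
      using weighted_AM_GM_strict[of b ?w t] t assms w neq[of b] by (simp add: mult.commute)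
    then have "(1 - q) * a < (1 - q) * ((1 - t) * b + t * ?w)" using 3 by simp
    also have "\<dots> = (1 - q) * b - (t * (1 - q)) * b + (t * (1 - q)) * ?w" by (simp add: algebra_simps)
    finally have "(1 - q) * a + q * b - ?w < 0" unfolding t(3) by (simp add: algebra_simps)
    moreover have "q * (1 - q) < 0" using 3 by (simp add: mult_neg_pos)
    ultimately show ?thesis by (rule divide_neg_neg)
  qed
qed

text \<open>The counterpart of \<open>powr_tangent_gap\<close> for \<open>q = 1\<close>, and with
  the arguments exchanged for \<open>q = 0\<close>.\<close>

lemma log_tangent_gap:
  fixes a b :: real
  assumes "0 < a" "0 < b" "a \<noteq> b"
  shows "0 < a - b + b * ln (b / a)"
proof -
  have "ln (a / b) < a / b - 1"
    using ln_le_minus_one[of "a / b"] ln_eq_minus_one[of "a / b"] assms by fastforce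
  then have "b * ln (a / b) < b * (a / b - 1)" using assms by simp
  then show ?thesis using assms by (simp add: ln_div algebra_simps)
qed

lemma partial_fractions:
  fixes q :: real
  assumes "q \<noteq> 0" "q \<noteq> 1"
  shows "x / q + y / (1 - q) + (- 1 / (q * (1 - q))) * w = ((1 - q) * x + q * y - w) / (q * (1 - q))"
  using assms by (simp add: add_divide_distrib diff_divide_distrib)

lemma div_density_self:
  assumes "0 \<le> a" shows "div_density q a a = 0"
  using assms
  by (simp add: div_density_def xlog_ratio_def epow_mult_epow_complement zero_ereal_def divide_simps
      flip: distrib_left)

lemma div_density_pos:
  assumes "0 \<le> a" "0 \<le> b" "a \<noteq> b"
  shows "0 < div_density q a b"
proof -
  consider "q = 1" | "q = 0" | "q \<noteq> 0" "q \<noteq> 1" by blast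
  then show ?thesis
  proof cases
    case 1
    then show ?thesis using assms log_tangent_gap[of a b]
      by (cases "a = 0"; cases "b = 0") (auto simp: div_density_def xlog_ratio_def)
  next
    case 2
    then show ?thesis using assms log_tangent_gap[of b a]
      by (cases "a = 0"; cases "b = 0") (auto simp: div_density_def xlog_ratio_def)
  next
    case 3
    \<comment> \<open>When exactly one argument vanishes, the power term is either \<open>0\<close>,
      leaving a positive linear term, or \<infinity> with a positive coefficient.\<close>
    consider "a = 0" "0 < b" | "b = 0" "0 < a" | "0 < a" "0 < b" using assms by fastforce
    then show ?thesis
    proof cases
      case 1
      show ?thesis
      proof (cases "q < 1")
        case True
        then show ?thesis using 1 3
          by (simp add: div_density_def epow_zero epow_ennreal zero_ennreal.rep_eq)
      next
        case False
        then have "q * (1 - q) < 0" using 3 by (simp add: mult_pos_neg)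
        then show ?thesis using False 1 3
          by (simp add: div_density_def epow_zero epow_ennreal ennreal_top_mult)
      qed
    next
      case 2
      show ?thesis
      proof (cases "0 < q")
        case True
        then show ?thesis using 2 3
          by (simp add: div_density_def epow_zero epow_ennreal zero_ennreal.rep_eq)
      next
        case False
        then have "q * (1 - q) < 0" using 3 by (simp add: mult_neg_pos)
        then show ?thesis using False 2 3
          by (simp add: div_density_def epow_zero epow_ennreal ennreal_mult_top)
      qed
    next
      case pos: 3
      have "div_density q a b = ereal (a / q + b / (1 - q) + (- 1 / (q * (1 - q))) * (a powr (1 - q) * b powr q))"
        using pos 3 by (simp add: div_density_def epow_ennreal flip: ennreal_mult)
      also have "a / q + b / (1 - q) + (- 1 / (q * (1 - q))) * (a powr (1 - q) * b powr q)
          = ((1 - q) * a + q * b - a powr (1 - q) * b powr q) / (q * (1 - q))"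
        using 3 by (intro partial_fractions)
      finally show ?thesis using powr_tangent_gap[of a b q] pos 3 assms by simp
    qed
  qed
qed

lemma div_density_nonneg: "0 \<le> a \<Longrightarrow> 0 \<le> b \<Longrightarrow> 0 \<le> div_density q a b"
  using div_density_pos[of a b q] div_density_self[of a q] by (cases "a = b") auto

lemma measurable_div_density [measurable (raw)]:
  assumes [measurable]: "f \<in> borel_measurable M" "g \<in> borel_measurable M"
  shows "(\<lambda>z. div_density q (f z) (g z)) \<in> borel_measurable M"
  unfolding div_density_def by measurable

section \<open>Divergences as integrals of a nonnegative density\<close>

text \<open>The masses are finite, so the linear terms can be moved under the extended integral.
  From here on the argument can run in \<open>ennreal\<close>, free of differences of
  infinities.\<close>

lemma alpha_divergence_eq_nn_integral:
  assumes p: "unnormalized_density M p" and r: "unnormalized_density M r" and \<alpha>: "\<alpha> = 2 * q - 1"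
  shows "alpha_divergence M \<alpha> p r = enn2ereal (\<integral>\<^sup>+z. e2ennreal (div_density q (p z) (r z)) \<partial>M)"
proof -
  have int [simp]: "integrable M p" "integrable M r"
    and nn: "\<And>z. z \<in> space M \<Longrightarrow> 0 \<le> p z" "\<And>z. z \<in> space M \<Longrightarrow> 0 \<le> r z"
    using p r by (auto simp: unnormalized_density_def)
  have [measurable]: "p \<in> borel_measurable M" "r \<in> borel_measurable M"
    using int by blast+
  note nonneg = div_density_nonneg[OF nn, of _ _ q]
  have \<alpha>_simps: "(1 - \<alpha>) / 2 = 1 - q" "(1 + \<alpha>) / 2 = q" "\<alpha> = 1 \<longleftrightarrow> q = 1" "\<alpha> = - 1 \<longleftrightarrow> q = 0"
    "1 - \<alpha>\<^sup>2 = 4 * (q * (1 - q))"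
    unfolding \<alpha> by (auto simp: power2_eq_square field_simps)
  consider "q = 1" | "q = 0" | "q \<noteq> 0" "q \<noteq> 1" by blast
  then show ?thesis
  proof cases
    case 1
    have "ereal (\<integral>z. p z - r z \<partial>M) + ext_integral M (\<lambda>z. xlog_ratio (r z) (p z))
        = enn2ereal (\<integral>\<^sup>+z. e2ennreal (div_density q (p z) (r z)) \<partial>M)"
      using nonneg 1 by (subst ext_integral_add_real) (auto simp: div_density_def)
    moreover have "alpha_divergence M \<alpha> p r
        = ereal (\<integral>z. p z - r z \<partial>M) + ext_integral M (\<lambda>z. xlog_ratio (r z) (p z))"
      using 1 \<alpha>_simps
      by (cases "ext_integral M (\<lambda>z. xlog_ratio (r z) (p z))")
         (simp_all add: alpha_divergence_def KL_unnormalized_def)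
    ultimately show ?thesis by simp
  next
    case 2
    have "ereal (\<integral>z. r z - p z \<partial>M) + ext_integral M (\<lambda>z. xlog_ratio (p z) (r z))
        = enn2ereal (\<integral>\<^sup>+z. e2ennreal (div_density q (p z) (r z)) \<partial>M)"
      using nonneg 2 by (subst ext_integral_add_real) (auto simp: div_density_def)
    moreover have "alpha_divergence M \<alpha> p r
        = ereal (\<integral>z. r z - p z \<partial>M) + ext_integral M (\<lambda>z. xlog_ratio (p z) (r z))"
      using 2 \<alpha>_simps
      by (cases "ext_integral M (\<lambda>z. xlog_ratio (p z) (r z))")
         (simp_all add: alpha_divergence_def KL_unnormalized_def)
    ultimately show ?thesis by simp
  next
    case 3
    let ?\<Phi> = "\<lambda>z. epow (ennreal (p z)) (1 - q) * epow (ennreal (r z)) q"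
    let ?I = "\<integral>\<^sup>+z. ?\<Phi> z \<partial>M"
    let ?P = "\<integral>z. p z \<partial>M" and ?R = "\<integral>z. r z \<partial>M"
    have "ereal (\<integral>z. p z / q + r z / (1 - q) \<partial>M)
          + ext_integral M (\<lambda>z. ereal (- 1 / (q * (1 - q))) * enn2ereal (?\<Phi> z))
        = enn2ereal (\<integral>\<^sup>+z. e2ennreal (div_density q (p z) (r z)) \<partial>M)"
      using nonneg 3 by (subst ext_integral_add_real) (auto simp: div_density_def)
    moreover have "ext_integral M (\<lambda>z. ereal (- 1 / (q * (1 - q))) * enn2ereal (?\<Phi> z))
        = ereal (- 1 / (q * (1 - q))) * enn2ereal ?I"
      by (rule ext_integral_cmult_ennreal) measurable
    moreover have "(\<integral>z. p z / q + r z / (1 - q) \<partial>M) = ?P / q + ?R / (1 - q)"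
      by simp
    moreover have "alpha_divergence M \<alpha> p r
        = ereal (1 / (q * (1 - q))) * (ereal ((1 - q) * ?P) + ereal (q * ?R) - enn2ereal ?I)"
      using 3 by (simp add: alpha_divergence_def \<alpha>_simps)
    moreover have "ereal (1 / (q * (1 - q))) * (ereal ((1 - q) * ?P) + ereal (q * ?R) - enn2ereal ?I)
        = ereal (?P / q + ?R / (1 - q)) + ereal (- 1 / (q * (1 - q))) * enn2ereal ?I"
    \<comment> \<open>If \<open>?I\<close> is infinite, both sides are infinite with the sign
      opposite to that of \<open>q * (1 - q)\<close>.\<close>
    proof (cases ?I)
      case (real i)
      have "1 / (q * (1 - q)) * ((1 - q) * ?P + q * ?R - i)
          = ?P / q + ?R / (1 - q) + (- 1 / (q * (1 - q))) * i"
        using partial_fractions[OF 3, of ?P ?R i] by simp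
      then show ?thesis using real by simp
    next
      case top
      then show ?thesis using 3 by (cases "0 < q * (1 - q)") (auto simp: divide_simps)
    qed
    ultimately show ?thesis by simp
  qed
qed


section \<open>The q-path as a power mean, and the pointwise compensation identity\<close>

lemma q_path_nonneg: "0 \<le> q_path \<beta> q p0 p1 z"
  by (simp add: q_path_def)

context
  fixes \<beta> q :: real and p0 p1 :: "'a \<Rightarrow> real" and z :: 'a
  assumes \<beta>: "0 \<le> \<beta>" "\<beta> \<le> 1" and p: "0 \<le> p0 z" "0 \<le> p1 z"
begin

lemma convex_comb_same: "ennreal (1 - \<beta>) * x + ennreal \<beta> * x = x"
  using \<beta> by (simp flip: distrib_right ennreal_plus)

text \<open>Replacing both endpoints by their maximum \<open>b\<close> can only raise the power
  mean, and the mean of \<open>b\<close> with itself is \<open>b\<close>. For \<open>q > 1\<close>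
  the inner and the outer power are both antitone, so the direction is kept. The bound also shows
  that \<open>enn2real\<close> loses nothing.\<close>

lemma
  shows ennreal_q_path: "ennreal (q_path \<beta> q p0 p1 z) =
     (if q = 1 then epow (ennreal (p0 z)) (1 - \<beta>) * epow (ennreal (p1 z)) \<beta>
      else epow (ennreal (1 - \<beta>) * epow (ennreal (p0 z)) (1 - q)
                + ennreal \<beta> * epow (ennreal (p1 z)) (1 - q)) (1 / (1 - q)))"
    and q_path_le_max: "q_path \<beta> q p0 p1 z \<le> max (p0 z) (p1 z)"
proof -
  define b where "b = max (p0 z) (p1 z)"
  define X where "X = ennreal (1 - \<beta>) * epow (ennreal (p0 z)) (1 - q)
                + ennreal \<beta> * epow (ennreal (p1 z)) (1 - q)"
  define E where "E = (if q = 1 then epow (ennreal (p0 z)) (1 - \<beta>) * epow (ennreal (p1 z)) \<beta>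
      else epow X (1 / (1 - q)))"
  have b: "0 \<le> b" "ennreal (p0 z) \<le> ennreal b" "ennreal (p1 z) \<le> ennreal b"
    using p by (auto simp: b_def intro!: ennreal_leI)
  have "E \<le> ennreal b"
  proof -
    consider "q = 1" | "q < 1" | "1 < q" by linarith
    then show ?thesis
    proof cases
      case 1
      then show ?thesis
        using mult_mono[OF epow_mono[OF b(2)] epow_mono[OF b(3)], of "1 - \<beta>" \<beta>] \<beta>
          epow_mult_epow_complement[OF b(1), of \<beta>]
        by (simp add: E_def)
    next
      case 2
      have "X \<le> ennreal (1 - \<beta>) * epow (ennreal b) (1 - q) + ennreal \<beta> * epow (ennreal b) (1 - q)"
        unfolding X_def using 2 b by (intro add_mono mult_left_mono epow_mono) auto
      then have "epow X (1 / (1 - q)) \<le> epow (epow (ennreal b) (1 - q)) (1 / (1 - q))"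
        using 2 by (intro epow_mono) (auto simp: convex_comb_same)
      then show ?thesis using 2 by (simp add: E_def epow_epow_inverse)
    next
      case 3
      have "ennreal (1 - \<beta>) * epow (ennreal b) (1 - q) + ennreal \<beta> * epow (ennreal b) (1 - q) \<le> X"
        unfolding X_def using 3 b by (intro add_mono mult_left_mono epow_antimono) auto
      then have "epow X (1 / (1 - q)) \<le> epow (epow (ennreal b) (1 - q)) (1 / (1 - q))"
        using 3 by (intro epow_antimono) (auto simp: convex_comb_same)
      then show ?thesis using 3 by (simp add: E_def epow_epow_inverse)
    qed
  qed
  moreover have "q_path \<beta> q p0 p1 z = enn2real E"
    by (simp add: q_path_def E_def X_def)
  ultimately have *: "ennreal (q_path \<beta> q p0 p1 z) = E \<and> q_path \<beta> q p0 p1 z \<le> b"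
    using b(1) by (cases E) (auto simp: top_unique)
  show "ennreal (q_path \<beta> q p0 p1 z) =
     (if q = 1 then epow (ennreal (p0 z)) (1 - \<beta>) * epow (ennreal (p1 z)) \<beta>
      else epow (ennreal (1 - \<beta>) * epow (ennreal (p0 z)) (1 - q)
                + ennreal \<beta> * epow (ennreal (p1 z)) (1 - q)) (1 / (1 - q)))"
    using * by (simp add: E_def X_def)
  show "q_path \<beta> q p0 p1 z \<le> max (p0 z) (p1 z)"
    using * by (simp add: b_def)
qed

lemma epow_q_path:
  assumes "q \<noteq> 1"
  shows "epow (ennreal (q_path \<beta> q p0 p1 z)) (1 - q)
    = ennreal (1 - \<beta>) * epow (ennreal (p0 z)) (1 - q) + ennreal \<beta> * epow (ennreal (p1 z)) (1 - q)"
  using assms by (simp add: ennreal_q_path epow_inverse_epow)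

text \<open>Apart from terms in \<open>a\<close> alone or \<open>c\<close> alone,
  \<open>div_density q a c\<close> is linear in \<open>a^(1-q)\<close>, or in \<open>ln a\<close>
  when \<open>q = 1\<close>. This is exactly the quantity that the q-path averages, so the cross
  terms of the endpoints combine into that of \<open>m\<close>.\<close>

lemma div_density_compensation:
  assumes c: "0 \<le> c"
  defines "m \<equiv> q_path \<beta> q p0 p1 z"
  shows "ereal (1 - \<beta>) * div_density q (p0 z) c + ereal \<beta> * div_density q (p1 z) c
    = ereal (1 - \<beta>) * div_density q (p0 z) m + ereal \<beta> * div_density q (p1 z) m
      + div_density q m c"
proof -
  have m0: "0 \<le> m" by (simp add: m_def q_path_nonneg)
  \<comment> \<open>The extreme weights are separated because a zero weight annihilates even an
    infinite term; positive weights preserve infinities.\<close>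
  consider "\<beta> = 0" | "\<beta> = 1" | "0 < \<beta>" "\<beta> < 1" using \<beta> by linarith
  then show ?thesis
  proof cases
    case 1
    then have "m = p0 z"
      using p by (simp add: m_def q_path_def epow_epow_inverse)
    then show ?thesis using 1 p by (simp add: div_density_self flip: one_ereal_def zero_ereal_def)
  next
    case 2
    then have "m = p1 z"
      using p by (simp add: m_def q_path_def epow_epow_inverse)
    then show ?thesis using 2 p by (simp add: div_density_self flip: one_ereal_def zero_ereal_def)
  next
    case \<beta>': 3
    consider "q = 1" | "q = 0" | "q \<noteq> 0" "q \<noteq> 1" by blast
    then show ?thesis
    proof cases
      case 1
      have E: "ennreal m = epow (ennreal (p0 z)) (1 - \<beta>) * epow (ennreal (p1 z)) \<beta>"
        using 1 ennreal_q_path by (simp add: m_def)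
      \<comment> \<open>A vanishing endpoint forces \<open>m = 0\<close>; both sides are then
        \<infinity> unless \<open>c = 0\<close>.\<close>
      show ?thesis
      proof (cases "p0 z = 0 \<or> p1 z = 0")
        case True
        then have "m = 0" using E \<beta>' m0 by (auto simp: epow_zero)
        then show ?thesis using True \<beta>' p c
          by (cases "p0 z = 0"; cases "p1 z = 0"; cases "c = 0")
            (auto simp: 1 div_density_def xlog_ratio_def algebra_simps)
      next
        case False
        then have pos: "0 < p0 z" "0 < p1 z" using p by auto
        then have m: "m = p0 z powr (1 - \<beta>) * p1 z powr \<beta>"
          using E m0 by (simp add: epow_ennreal flip: ennreal_mult)
        then have mpos: "0 < m" using pos by simp
        have ln_m: "ln m = (1 - \<beta>) * ln (p0 z) + \<beta> * ln (p1 z)"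
          using pos by (simp add: m ln_mult ln_powr)
        show ?thesis
        proof (cases "c = 0")
          case True
          then show ?thesis using pos mpos
            by (simp add: 1 div_density_def xlog_ratio_def ln_div ln_m) (simp add: algebra_simps)
        next
          case False
          then show ?thesis using pos mpos c
            by (simp add: 1 div_density_def xlog_ratio_def ln_div ln_m) (simp add: algebra_simps)
        qed
      qed
    next
      case 2
      have m: "m = (1 - \<beta>) * p0 z + \<beta> * p1 z"
        using \<beta>' p m0 ennreal_q_path 2
        by (simp add: m_def flip: ennreal_mult ennreal_plus)
      show ?thesis
      proof (cases "p0 z = 0 \<and> p1 z = 0")
        case True
        then have "m = 0" using m by simp
        then show ?thesis using True \<beta>' p c
          by (auto simp: 2 div_density_def xlog_ratio_def algebra_simps)
      next
        case False
        have "0 \<le> (1 - \<beta>) * p0 z" "0 \<le> \<beta> * p1 z" using p \<beta>' by auto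
        moreover have "(1 - \<beta>) * p0 z \<noteq> 0 \<or> \<beta> * p1 z \<noteq> 0" using False \<beta>' by auto
        ultimately have mpos: "0 < m" unfolding m by linarith
        show ?thesis
        \<comment> \<open>At \<open>c = 0\<close> both sides are \<infinity>, since \<open>m\<close>
          and at least one endpoint are positive.\<close>
        proof (cases "c = 0")
          case True
          then show ?thesis using False \<beta>' p mpos
            by (cases "p0 z = 0"; cases "p1 z = 0") (auto simp: 2 div_density_def xlog_ratio_def)
        next
          case c0: False
          have fin: "div_density q a d = ereal (d - a + (a * ln a - a * ln d))"
            if "0 \<le> a" "0 < d" for a d
            using that by (simp add: 2 div_density_def xlog_ratio_def ln_div algebra_simps)
          \<comment> \<open>The logarithm of \<open>m\<close> is kept opaque, so that the mixture is
            substituted only into the linear occurrences of \<open>m\<close>.\<close>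
          define L K where "L = ln m" and "K = ln c"
          show ?thesis using c c0 p mpos m0
            by (simp add: fin flip: L_def K_def) (simp add: m algebra_simps)
        qed
      qed
    next
      case 3
      define \<Phi> where "\<Phi> = (\<lambda>a c. epow (ennreal a) (1 - q) * epow (ennreal c) q)"
      define k where "k = - 1 / (q * (1 - q))"
      have k: "k \<noteq> 0" "k = - 1 / q - 1 / (1 - q)" using 3 by (auto simp: k_def field_simps)
      have dd: "div_density q a d = ereal (a / q + d / (1 - q)) + ereal k * enn2ereal (\<Phi> a d)" for a d
        using 3 by (simp add: div_density_def \<Phi>_def k_def)
      have comb: "\<Phi> m d = ennreal (1 - \<beta>) * \<Phi> (p0 z) d + ennreal \<beta> * \<Phi> (p1 z) d" for d
        unfolding \<Phi>_def m_def epow_q_path[OF 3(2)] by (simp add: algebra_simps)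
      have "\<Phi> m m = ennreal m"
        using m0 by (simp add: \<Phi>_def epow_mult_epow_complement)
      then have comb_m: "ennreal m = ennreal (1 - \<beta>) * \<Phi> (p0 z) m + ennreal \<beta> * \<Phi> (p1 z) m"
        using comb[of m] by simp
      \<comment> \<open>The cross terms at \<open>m\<close> are finite because their mixture with
        positive weights is the real number \<open>m\<close>.\<close>
      obtain f0 f1 where f: "\<Phi> (p0 z) m = ennreal f0" "\<Phi> (p1 z) m = ennreal f1" "0 \<le> f0" "0 \<le> f1"
        using comb_m \<beta>'
        by (cases "\<Phi> (p0 z) m"; cases "\<Phi> (p1 z) m") (auto simp: ennreal_mult_top)
      have mf: "m = (1 - \<beta>) * f0 + \<beta> * f1"
        using comb_m f \<beta>' m0 by (simp flip: ennreal_mult ennreal_plus)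
      show ?thesis
      proof (cases "\<Phi> (p0 z) c = top \<or> \<Phi> (p1 z) c = top")
        case True
        then have top: "\<Phi> m c = top" using \<beta>' by (auto simp: comb ennreal_mult_top)
        show ?thesis using True k(1) \<beta>' f
          by (cases "\<Phi> (p0 z) c"; cases "\<Phi> (p1 z) c"; cases "0 < k") (auto simp: dd top)
      next
        case False
        then obtain g0 g1 where g: "\<Phi> (p0 z) c = ennreal g0" "\<Phi> (p1 z) c = ennreal g1" "0 \<le> g0" "0 \<le> g1"
          by (cases "\<Phi> (p0 z) c"; cases "\<Phi> (p1 z) c") auto
        have "\<Phi> m c = ennreal ((1 - \<beta>) * g0 + \<beta> * g1)"
          using g \<beta>' by (simp add: comb flip: ennreal_mult ennreal_plus)
        moreover have "(1 - \<beta>) * (p0 z / q + c / (1 - q) + k * g0) + \<beta> * (p1 z / q + c / (1 - q) + k * g1)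
          = (1 - \<beta>) * (p0 z / q + m / (1 - q) + k * f0) + \<beta> * (p1 z / q + m / (1 - q) + k * f1)
            + (m / q + c / (1 - q) + k * ((1 - \<beta>) * g0 + \<beta> * g1))"
        proof -
          \<comment> \<open>All terms in \<open>m\<close> cancel: the cross terms at
            \<open>m\<close> average to \<open>m\<close>, and \<open>k\<close> is minus the sum of
            the two linear coefficients.\<close>
          have "m / (1 - q) + m / q + k * ((1 - \<beta>) * f0 + \<beta> * f1) = 0"
            unfolding mf[symmetric] k(2) by (simp add: algebra_simps)
          moreover have "(1 - \<beta>) * (A0 + C + k * g0) + \<beta> * (A1 + C + k * g1)
            = (1 - \<beta>) * (A0 + S + k * f0) + \<beta> * (A1 + S + k * f1) + (T + C + k * ((1 - \<beta>) * g0 + \<beta> * g1))"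
            if "S + T + k * ((1 - \<beta>) * f0 + \<beta> * f1) = 0" for A0 A1 C S T
            using that by (simp add: algebra_simps)
          ultimately show ?thesis by blast
        qed
        ultimately show ?thesis
          using f g \<beta>' by (simp add: dd del: ennreal_plus)
      qed
    qed
  qed
qed

end

section \<open>Integrable bounds: a competitor with finite objective, and the mass of the
  q-path\<close>

text \<open>The order condition tames the cross term: the logarithmic terms become nonpositive, and
  for \<open>q\<close> outside [0, 1] the negative exponent falls on the larger argument.\<close>

lemma div_density_bound:
  "\<exists>K\<ge>0. \<forall>a\<ge>0. \<forall>b\<ge>0. (if q < 1 then a \<le> b else b \<le> a) \<longrightarrow> div_density q a b \<le> ereal (K * (a + b))"
proof -
  consider "q = 1" | "q = 0" | "q \<noteq> 0" "q \<noteq> 1" by blast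
  then show ?thesis
  proof cases
    case 1
    have "div_density q a b \<le> ereal (1 * (a + b))" if "0 \<le> a" "0 \<le> b" "b \<le> a" for a b
      using that mult_left_mono[of "ln b" "ln a" b] add_increasing2[of "b * 2" "b * ln b" "b * ln a"]
      by (cases "b = 0") (auto simp: 1 div_density_def xlog_ratio_def ln_div algebra_simps)
    then show ?thesis using 1 by (intro exI[of _ 1]) auto
  next
    case 2
    have "div_density q a b \<le> ereal (1 * (a + b))" if "0 \<le> a" "0 \<le> b" "a \<le> b" for a b
      using that mult_left_mono[of "ln a" "ln b" a] add_increasing2[of "a * 2" "a * ln a" "a * ln b"]
      by (cases "a = 0") (auto simp: 2 div_density_def xlog_ratio_def ln_div algebra_simps)
    then show ?thesis using 2 by (intro exI[of _ 1]) auto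
  next
    case 3
    define k where "k = - 1 / (q * (1 - q))"
    have "div_density q a b \<le> ereal ((\<bar>1 / q\<bar> + \<bar>1 / (1 - q)\<bar> + \<bar>k\<bar>) * (a + b))"
      if ab: "0 \<le> a" "0 \<le> b" and ord: "if q < 1 then a \<le> b else b \<le> a" for a b
    proof -
      let ?\<Phi> = "epow (ennreal a) (1 - q) * epow (ennreal b) q"
      have lin: "a / q + b / (1 - q) \<le> (\<bar>1 / q\<bar> + \<bar>1 / (1 - q)\<bar>) * (a + b)"
      proof -
        have "a / q \<le> \<bar>1 / q\<bar> * a" "b / (1 - q) \<le> \<bar>1 / (1 - q)\<bar> * b"
          using mult_right_mono[OF abs_ge_self[of "1 / q"] ab(1)]
            mult_right_mono[OF abs_ge_self[of "1 / (1 - q)"] ab(2)] by simp_all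
        moreover have "0 \<le> \<bar>1 / q\<bar> * b" "0 \<le> \<bar>1 / (1 - q)\<bar> * a" using ab by auto
        ultimately show ?thesis by (simp only: distrib_left distrib_right)
      qed
      have "ereal k * enn2ereal ?\<Phi> \<le> ereal (\<bar>k\<bar> * (a + b))"
      \<comment> \<open>Between 0 and 1 the coefficient \<open>k\<close> is negative, so the power
        term only lowers the density.\<close>
      proof (cases "0 < q \<and> q < 1")
        case True
        then have "k \<le> 0" by (simp add: k_def)
        then have "ereal k * enn2ereal ?\<Phi> \<le> 0" by (simp add: ereal_mult_le_0_iff)
        also have "0 \<le> ereal (\<bar>k\<bar> * (a + b))" using ab by simp
        finally show ?thesis .
      next
        case False
        \<comment> \<open>Replacing the larger argument, whose exponent is negative, by the smaller
          one raises the product to the smaller argument itself.\<close>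
        have "?\<Phi> \<le> ennreal (a + b)"
        proof (cases "q < 1")
          case True
          then have "?\<Phi> \<le> epow (ennreal a) (1 - q) * epow (ennreal a) q"
            using False ord by (intro mult_left_mono epow_antimono ennreal_leI) auto
          also have "\<dots> = ennreal a" using ab by (intro epow_mult_epow_complement)
          also have "\<dots> \<le> ennreal (a + b)" using ab by (intro ennreal_leI) simp
          finally show ?thesis .
        next
          case F: False
          then have "?\<Phi> \<le> epow (ennreal b) (1 - q) * epow (ennreal b) q"
            using ord by (intro mult_right_mono epow_antimono ennreal_leI) auto
          also have "\<dots> = ennreal b" using ab by (intro epow_mult_epow_complement)
          also have "\<dots> \<le> ennreal (a + b)" using ab by (intro ennreal_leI) simp
          finally show ?thesis .
        qed
        then obtain f where f: "?\<Phi> = ennreal f" "0 \<le> f" "f \<le> a + b"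
          using ab by (cases ?\<Phi>) (auto simp: top_unique simp del: ennreal_plus)
        have "k * f \<le> \<bar>k\<bar> * f" using f by (intro mult_right_mono) auto
        also have "\<dots> \<le> \<bar>k\<bar> * (a + b)" using f by (intro mult_left_mono) auto
        finally show ?thesis using f by simp
      qed
      then have "div_density q a b \<le> ereal ((\<bar>1 / q\<bar> + \<bar>1 / (1 - q)\<bar>) * (a + b)) + ereal (\<bar>k\<bar> * (a + b))"
        using lin 3 unfolding div_density_def k_def[symmetric] by (auto intro!: add_mono simp del: plus_ereal.simps)
      then show ?thesis by (simp add: algebra_simps)
    qed
    then show ?thesis by (intro exI[of _ "\<bar>1 / q\<bar> + \<bar>1 / (1 - q)\<bar> + \<bar>k\<bar>"]) auto
  qed
qed

text \<open>Feasibility of the candidate minimizer: it is dominated by the pointwise maximum of the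
  endpoints, which is integrable.\<close>

lemma unnormalized_density_q_path:
  assumes p0: "unnormalized_density M p0" and p1: "unnormalized_density M p1"
    and \<beta>: "0 \<le> \<beta>" "\<beta> \<le> 1"
  shows "unnormalized_density M (q_path \<beta> q p0 p1)"
proof -
  have int [simp]: "integrable M p0" "integrable M p1"
    and nn: "\<And>z. z \<in> space M \<Longrightarrow> 0 \<le> p0 z" "\<And>z. z \<in> space M \<Longrightarrow> 0 \<le> p1 z"
    using p0 p1 by (auto simp: unnormalized_density_def)
  have [measurable]: "p0 \<in> borel_measurable M" "p1 \<in> borel_measurable M"
    using int by blast+
  have [measurable]: "(\<lambda>z. q_path \<beta> q p0 p1 z) \<in> borel_measurable M"
    unfolding q_path_def by measurable
  have "integrable M (q_path \<beta> q p0 p1)"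
  proof (rule Bochner_Integration.integrable_bound)
    show "integrable M (\<lambda>z. max (p0 z) (p1 z))" by simp
    show "AE z in M. norm (q_path \<beta> q p0 p1 z) \<le> norm (max (p0 z) (p1 z))"
    proof (rule AE_I2)
      fix z assume "z \<in> space M"
      then show "norm (q_path \<beta> q p0 p1 z) \<le> norm (max (p0 z) (p1 z))"
        using q_path_le_max[of \<beta> p0 z p1 q] q_path_nonneg[of \<beta> q p0 p1 z] nn \<beta>
        by fastforce
    qed
  qed measurable
  then show ?thesis
    using q_path_nonneg nn \<beta> by (auto simp: unnormalized_density_def)
qed

section \<open>Integrated compensation, minimality and uniqueness\<close>

text \<open>The objective sees a density only through integrals, so uniqueness of the minimizer is
  up to null sets.\<close>

theorem mainTheorem1:
  fixes M :: "'a measure" and \<pi>0 \<pi>1 :: "'a \<Rightarrow> real" and \<beta> q \<alpha> :: real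
  assumes "unnormalized_density M \<pi>0" and "unnormalized_density M \<pi>1"
    and "\<beta> \<in> {0..1}"
    and "\<alpha> = 2 * q - 1"
  shows "is_arg_min (expected_alpha_divergence M \<alpha> \<beta> \<pi>0 \<pi>1) (unnormalized_density M)
           (q_path \<beta> q \<pi>0 \<pi>1)
       \<and> (\<forall>r. is_arg_min (expected_alpha_divergence M \<alpha> \<beta> \<pi>0 \<pi>1) (unnormalized_density M) r
              \<longrightarrow> (AE z in M. r z = q_path \<beta> q \<pi>0 \<pi>1 z))"
proof -
  let ?E = "expected_alpha_divergence M \<alpha> \<beta> \<pi>0 \<pi>1"
  let ?m = "q_path \<beta> q \<pi>0 \<pi>1"
  define D where "D p r = (\<integral>\<^sup>+z. e2ennreal (div_density q (p z) (r z)) \<partial>M)" for p r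
  have \<beta>: "0 \<le> \<beta>" "\<beta> \<le> 1" using assms(3) by auto
  have \<pi>_nonneg: "\<And>z. z \<in> space M \<Longrightarrow> 0 \<le> \<pi>0 z" "\<And>z. z \<in> space M \<Longrightarrow> 0 \<le> \<pi>1 z"
    using assms by (auto simp: unnormalized_density_def)
  have [measurable]: "r \<in> borel_measurable M" if "unnormalized_density M r" for r
    using that by (auto simp: unnormalized_density_def)
  note [measurable] = this[OF assms(1)] this[OF assms(2)]
  have m: "unnormalized_density M ?m"
    using assms \<beta> by (intro unnormalized_density_q_path)
  have E: "?E r = enn2ereal (ennreal (1 - \<beta>) * D \<pi>0 r + ennreal \<beta> * D \<pi>1 r)"
    if r: "unnormalized_density M r" for r
    using alpha_divergence_eq_nn_integral[OF assms(1) r assms(4)]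
      alpha_divergence_eq_nn_integral[OF assms(2) r assms(4)] \<beta>
    by (simp add: expected_alpha_divergence_def D_def plus_ennreal.rep_eq times_ennreal.rep_eq)
  have compensation: "ennreal (1 - \<beta>) * D \<pi>0 r + ennreal \<beta> * D \<pi>1 r
      = (ennreal (1 - \<beta>) * D \<pi>0 ?m + ennreal \<beta> * D \<pi>1 ?m) + D ?m r"
    if r: "unnormalized_density M r" for r
  proof -
    let ?d = "\<lambda>a b. e2ennreal (div_density q a b)"
    have [measurable]: "r \<in> borel_measurable M" "?m \<in> borel_measurable M"
      using r m by (auto simp: unnormalized_density_def)
    have mix: "ennreal (1 - \<beta>) * D \<pi>0 s + ennreal \<beta> * D \<pi>1 s
        = (\<integral>\<^sup>+z. ennreal (1 - \<beta>) * ?d (\<pi>0 z) (s z) + ennreal \<beta> * ?d (\<pi>1 z) (s z) \<partial>M)"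
      if [measurable]: "s \<in> borel_measurable M" for s
      by (simp add: D_def nn_integral_add nn_integral_cmult)
    have pt: "ennreal (1 - \<beta>) * ?d (\<pi>0 z) (r z) + ennreal \<beta> * ?d (\<pi>1 z) (r z)
      = (ennreal (1 - \<beta>) * ?d (\<pi>0 z) (?m z) + ennreal \<beta> * ?d (\<pi>1 z) (?m z)) + ?d (?m z) (r z)"
      if z: "z \<in> space M" for z
    proof -
      have nn: "0 \<le> \<pi>0 z" "0 \<le> \<pi>1 z" "0 \<le> r z" "0 \<le> ?m z"
        using z r m \<pi>_nonneg by (auto simp: unnormalized_density_def)
      show ?thesis
        \<comment> \<open>All densities are nonnegative here, so the \<open>ereal\<close> identity
          carries over to \<open>ennreal\<close> by injectivity of \<open>enn2ereal\<close>.\<close>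
        using div_density_compensation[of \<beta> \<pi>0 z \<pi>1 "r z" q] nn \<beta>
        by (simp add: div_density_nonneg enn2ereal_e2ennreal plus_ennreal.rep_eq
            times_ennreal.rep_eq flip: enn2ereal_inject)
    qed
    have "ennreal (1 - \<beta>) * D \<pi>0 r + ennreal \<beta> * D \<pi>1 r
      = (\<integral>\<^sup>+z. (ennreal (1 - \<beta>) * ?d (\<pi>0 z) (?m z) + ennreal \<beta> * ?d (\<pi>1 z) (?m z)) + ?d (?m z) (r z) \<partial>M)"
      unfolding mix[OF \<open>r \<in> borel_measurable M\<close>] by (intro nn_integral_cong pt)
    also have "\<dots> = (\<integral>\<^sup>+z. ennreal (1 - \<beta>) * ?d (\<pi>0 z) (?m z) + ennreal \<beta> * ?d (\<pi>1 z) (?m z) \<partial>M) + D ?m r"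
      unfolding D_def by (rule nn_integral_add) measurable
    finally show ?thesis unfolding mix[OF \<open>?m \<in> borel_measurable M\<close>] .
  qed
  have finite: "ennreal (1 - \<beta>) * D \<pi>0 ?m + ennreal \<beta> * D \<pi>1 ?m < \<infinity>"
  proof -
    \<comment> \<open>This \<open>s\<close> lies above both endpoints for \<open>q < 1\<close> and
      below both otherwise, so \<open>div_density_bound\<close> applies to either endpoint.\<close>
    define s where "s z = (if q < 1 then \<pi>0 z + \<pi>1 z else min (\<pi>0 z) (\<pi>1 z))" for z
    have s: "unnormalized_density M s"
      using assms unfolding s_def by (cases "q < 1") (auto simp: unnormalized_density_def)
    obtain K where K: "0 \<le> K" and bound: "\<And>a b. 0 \<le> a \<Longrightarrow> 0 \<le> b \<Longrightarrow>
        (if q < 1 then a \<le> b else b \<le> a) \<Longrightarrow> div_density q a b \<le> ereal (K * (a + b))"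
      using div_density_bound[of q] by blast
    have "D p s < \<infinity>" if p: "unnormalized_density M p" "p = \<pi>0 \<or> p = \<pi>1" for p
    proof -
      have "D p s \<le> (\<integral>\<^sup>+z. ennreal (K * (p z + s z)) \<partial>M)"
        unfolding D_def
      proof (intro nn_integral_mono)
        fix z assume z: "z \<in> space M"
        have "div_density q (p z) (s z) \<le> ereal (K * (p z + s z))"
          using p(2) \<pi>_nonneg[OF z] by (intro bound) (auto simp: s_def)
        from e2ennreal_mono[OF this]
        show "e2ennreal (div_density q (p z) (s z)) \<le> ennreal (K * (p z + s z))" by simp
      qed
      also have "\<dots> < \<infinity>"
      proof -
        have "integrable M (\<lambda>z. K * (p z + s z))"
          using p s by (auto simp: unnormalized_density_def)
        then show ?thesis unfolding real_integrable_def by (simp only: less_top infinity_ennreal_def)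
      qed
      finally show ?thesis .
    qed
    then have "ennreal (1 - \<beta>) * D \<pi>0 s + ennreal \<beta> * D \<pi>1 s < \<infinity>"
      using assms by (simp add: ennreal_mult_less_top)
    \<comment> \<open>By compensation the finite value at \<open>s\<close> is the value at
      \<open>?m\<close> plus a nonnegative gap.\<close>
    then show ?thesis unfolding compensation[OF s] by simp
  qed
  have gap_zero: "AE z in M. r z = ?m z" if r: "unnormalized_density M r" and 0: "D ?m r = 0" for r
  proof -
    have [measurable]: "r \<in> borel_measurable M" "?m \<in> borel_measurable M"
      using r m by (auto simp: unnormalized_density_def)
    \<comment> \<open>A nonnegative density with zero integral vanishes almost everywhere, and it is
      strictly positive wherever \<open>r\<close> and \<open>?m\<close> differ.\<close>
    have "AE z in M. e2ennreal (div_density q (?m z) (r z)) = 0"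
      using 0 unfolding D_def by (subst (asm) nn_integral_0_iff_AE) auto
    then show ?thesis
      using AE_space
    proof eventually_elim
      case (elim z)
      then have "0 \<le> r z" "0 \<le> ?m z" using r m by (auto simp: unnormalized_density_def)
      then show ?case
        using elim(1) div_density_pos[of "?m z" "r z" q] enn2ereal_e2ennreal[of "div_density q (?m z) (r z)"]
        by (cases "r z = ?m z") (auto simp: zero_ennreal.rep_eq less_imp_le)
    qed
  qed
  define C where "C = ennreal (1 - \<beta>) * D \<pi>0 ?m + ennreal \<beta> * D \<pi>1 ?m"
  have E_m: "?E ?m = enn2ereal C"
    unfolding C_def by (rule E[OF m])
  have E_r: "?E r = enn2ereal (C + D ?m r)" if "unnormalized_density M r" for r
    unfolding C_def E[OF that] compensation[OF that] ..
  have le_iff: "?E r \<le> ?E ?m \<longleftrightarrow> C + D ?m r \<le> C" if "unnormalized_density M r" for r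
    unfolding E_m E_r[OF that] by (simp add: less_eq_ennreal.rep_eq)
  have ge: "?E ?m \<le> ?E r" if "unnormalized_density M r" for r
    unfolding E_m E_r[OF that] by (simp flip: less_eq_ennreal.rep_eq)
  show ?thesis
  proof (intro conjI allI impI)
    show "is_arg_min ?E (unnormalized_density M) ?m"
      unfolding is_arg_min_def using m ge by (meson not_less)
    fix r assume min: "is_arg_min ?E (unnormalized_density M) r"
    then have r: "unnormalized_density M r" and "?E r \<le> ?E ?m"
      unfolding is_arg_min_def using m by (meson not_less)+
    then have "C + D ?m r \<le> C + 0"
      using le_iff by simp
    \<comment> \<open>Cancelling \<open>C\<close> is legitimate only because it is finite.\<close>
    then have "D ?m r \<le> 0"
      using finite unfolding C_def[symmetric] ennreal_add_left_cancel_le by auto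
    then show "AE z in M. r z = ?m z" using gap_zero r by simp
  qed
qed

end
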